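(* Let $p_A,p_B\in(0,1)$ with $p_A\ne p_B$, $q_A=1-p_A$, $q_B=1-p_B$, and let $J=2$. For every nonrandom periodic pattern strategy $D$ (with $r\ge1$ letters $A$ and $s\ge1$ letters $B$, in any order), the casino's asymptotic profit per coup $R_D$ attributable to the two-armed feature of the machine satisfies $$R_D>0.$$ In particular, the Parrondo effect is present for every nonrandom periodic pattern strategy $D$.
   Context: **Pattern strategies.** A nonrandom periodic pattern strategy $D$ is a finite word $D=D_1D_2\cdots D_n$ in the letters $A,B$ containing $r\ge1$ letters $A$ and $s\ge1$ letters $B$, $n=r+s$; the player pulls the arms in the order of the word and repeats the word indefinitely. Put $p_i=p_A$, $q_i=q_A$ if $D_i=A$ and $p_i=p_B$, $q_i=q_B$ if $D_i=B$, extended $n$-periodically in $i$. **Two-armed Futurity machine with $J=2$.** At each coup arm $A$ (resp. $B$) wins a non-Futurity payout with probability $p_A$ (resp. $p_B$), independently of the past, and otherwise loses. A pointer records the current number ($0$ or $1$) of consecutive losses; whenever it would reach $J=2$, the Futurity award of $2$ coins is paid and the pointer resets to $0$; a win resets it to $0$. Under $D$ this is the Markov chain on $\{0,\dots,2n-1\}\times\{0,1\}$ with transitions $(i,0)\to(i+1\bmod 2n,0)$ with probability $p_{i+1}$, $(i,0)\to(i+1\bmod 2n,1)$ with probability $q_{i+1}$, and $(i,1)\to(i+1\bmod 2n,0)$ with probability $1$. With $\pi$ its unique stationary distribution, the asymptotic probability per coup of winning the Futurity award is $p_D^\circ=\sum_{i=0}^{2n-1}\pi(i,1)q_{i+1}$.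 It is a known result of Ethier and Lee that $$p_D^\circ=\frac1{r+s}\sum_{k=1}^{r+s}\Big(\sum_{j=1}^{r+s}p_j\prod_{i=j+1}^{j+2k}q_i\Big)\frac1{1-(q_A^rq_B^s)^2}.$$ If only arm $A$ (resp. only arm $B$) is played, the corresponding probability is $p_A^\circ=\frac{p_Aq_A^2}{1-q_A^2}$ (resp. $p_B^\circ=\frac{p_Bq_B^2}{1-q_B^2}$). **Profit.** Let $u_A$ (resp. $u_B$) be the conditional mean non-Futurity payout of arm $A$ (resp. $B$) given a win. The asymptotic mean payouts per coup, including the Futurity award, are $\mu_A^*=p_Au_A+2p_A^\circ$, $\mu_B^*=p_Bu_B+2p_B^\circ$ when a single arm is played, and $\mu_D^*=\frac{r}{r+s}p_Au_A+\frac{s}{r+s}p_Bu_B+2p_D^\circ$ under $D$. The casino's asymptotic profit per coup attributable to the two-armed feature of the machine is $$R_D=\frac{r}{r+s}\mu_A^*+\frac{s}{r+s}\mu_B^*-\mu_D^*=2\Big(\frac{r}{r+s}p_A^\circ+\frac{s}{r+s}p_B^\circ-p_D^\circ\Big).$$ **Parrondo effect.** One coin is charged per coup; an arm is fair if its asymptotic mean payout per coup is $1$. The Parrondo effect is present for $D$ if, when both arms are individually fair ($\mu_A^*=\mu_B^*=1$), the casino's asymptotic profit per coup $1-\mu_D^*$ under $D$ is positive; this is equivalent to $p_D^\circ<\frac{rp_A^\circ+sp_B^\circ}{r+s}$. *)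

theory Defs
  imports "HOL-Probability.Probability"
begin

datatype arm = A | B

text \<open>
  Throughout, \<open>p a\<close> is the probability that arm \<open>a\<close> wins a non-Futurity payout, \<open>u a\<close> is its
  conditional mean non-Futurity payout given a win, and the word \<open>D\<close> is repeated indefinitely.
  Positions are counted from 0, so \<open>pulled_arm D i\<close> is the arm pulled out of a state \<open>(i, _)\<close>,
  i.e. letter number \<open>i + 1\<close> of the periodically extended word.
\<close>

definition pulled_arm :: "arm list \<Rightarrow> nat \<Rightarrow> arm" where
  "pulled_arm D i = D ! (i mod length D)"

text \<open>
  A state \<open>(i, l)\<close> consists of the position \<open>i\<close> modulo twice the length of the word and the
  pointer \<open>l\<close>. With \<open>J = 2\<close>, a pointer at 1 is always reset: by a win, or by a second loss, which
  pays the Futurity award.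
\<close>

definition futurity_kernel :: "(arm \<Rightarrow> real) \<Rightarrow> arm list \<Rightarrow> nat \<times> nat \<Rightarrow> (nat \<times> nat) pmf" where
  "futurity_kernel p D = (\<lambda>(i, l).
     let i' = Suc i mod (2 * length D)
     in if l = 0
        then map_pmf (\<lambda>win. (i', if win then 0 else 1)) (bernoulli_pmf (p (pulled_arm D i)))
        else return_pmf (i', 0))"

definition stationary_distribution :: "(arm \<Rightarrow> real) \<Rightarrow> arm list \<Rightarrow> (nat \<times> nat) pmf \<Rightarrow> bool" where
  "stationary_distribution p D \<pi> \<longleftrightarrow>
     set_pmf \<pi> \<subseteq> {0..<2 * length D} \<times> {0, 1} \<and> bind_pmf \<pi> (futurity_kernel p D) = \<pi>"

text \<open>The description is proper whenever \<open>0 < p a < 1\<close>: see \<open>ex1_stationary_distribution\<close> below.\<close>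

definition stationary_pmf :: "(arm \<Rightarrow> real) \<Rightarrow> arm list \<Rightarrow> (nat \<times> nat) pmf" where
  "stationary_pmf p D = (THE \<pi>. stationary_distribution p D \<pi>)"

definition futurity_prob :: "(arm \<Rightarrow> real) \<Rightarrow> arm list \<Rightarrow> real" where
  "futurity_prob p D =
     (\<Sum>i<2 * length D. pmf (stationary_pmf p D) (i, 1) * (1 - p (pulled_arm D i)))"

text \<open>
  Playing only arm \<open>a\<close> means repeating the one-letter word \<open>[a]\<close>; the closed form is
  \<open>arm_futurity_prob_eq\<close> below.
\<close>

definition arm_futurity_prob :: "(arm \<Rightarrow> real) \<Rightarrow> arm \<Rightarrow> real" where
  "arm_futurity_prob p a = futurity_prob p [a]"

definition arm_mean_payout :: "(arm \<Rightarrow> real) \<Rightarrow> (arm \<Rightarrow> real) \<Rightarrow> arm \<Rightarrow> real" where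
  "arm_mean_payout p u a = p a * u a + 2 * arm_futurity_prob p a"

definition arm_freq :: "arm list \<Rightarrow> arm \<Rightarrow> real" where
  "arm_freq D a = real (count_list D a) / real (length D)"

definition pattern_mean_payout :: "(arm \<Rightarrow> real) \<Rightarrow> (arm \<Rightarrow> real) \<Rightarrow> arm list \<Rightarrow> real" where
  "pattern_mean_payout p u D =
     arm_freq D A * (p A * u A) + arm_freq D B * (p B * u B) + 2 * futurity_prob p D"

definition two_armed_profit :: "(arm \<Rightarrow> real) \<Rightarrow> (arm \<Rightarrow> real) \<Rightarrow> arm list \<Rightarrow> real" where
  "two_armed_profit p u D =
     arm_freq D A * arm_mean_payout p u A + arm_freq D B * arm_mean_payout p u B
       - pattern_mean_payout p u D"

text \<open>
  One coin is charged per coup, so an arm is fair if its mean payout is 1. Given \<open>p\<close>, fairness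
  determines \<open>u\<close>, so exactly one assignment of payouts satisfies the premise; see
  \<open>parrondo_effect_iff\<close> below for the equivalent condition on the Futurity probabilities.
\<close>

definition parrondo_effect :: "(arm \<Rightarrow> real) \<Rightarrow> arm list \<Rightarrow> bool" where
  "parrondo_effect p D \<longleftrightarrow>
     (\<forall>u. arm_mean_payout p u A = 1 \<and> arm_mean_payout p u B = 1
        \<longrightarrow> 1 - pattern_mean_payout p u D > 0)"

lemma pulled_arm_mod: "pulled_arm D (i mod (2 * length D)) = pulled_arm D i"
  by (simp add: pulled_arm_def mod_mod_cancel)

lemma sum_times_01:
  fixes f :: "nat \<times> nat \<Rightarrow> real"
  shows "sum f ({0..<N} \<times> {0, 1}) = (\<Sum>i<N. f (i, 0) + f (i, 1))"
proof -
  have "sum f ({0..<N} \<times> {0, 1}) = (\<Sum>i<N. \<Sum>l\<in>{0, 1}. f (i, l))"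
    by (simp only: sum.cartesian_product lessThan_atLeast0 case_prod_unfold prod.collapse)
  then show ?thesis by simp
qed

lemma Suc_mod_inj:
  assumes "i < N" "j < N" "Suc i mod N = Suc j mod N"
  shows "i = j"
  using assms by (auto simp: mod_Suc split: if_splits)

lemma pmf_futurity_kernel:
  assumes "0 < p (pulled_arm D i)" "p (pulled_arm D i) < 1"
  shows "pmf (futurity_kernel p D (i, l)) (k, m) =
    (if k = Suc i mod (2 * length D) then
       if l = 0 then
         (if m = 0 then p (pulled_arm D i) else if m = 1 then 1 - p (pulled_arm D i) else 0)
       else if m = 0 then 1 else 0
     else 0)"
proof (cases "l = 0")
  case True
  let ?k = "Suc i mod (2 * length D)"
  have "pmf (futurity_kernel p D (i, l)) (k, m) =
      pmf (bernoulli_pmf (p (pulled_arm D i)) \<bind> (\<lambda>w. return_pmf (?k, if w then 0 else 1))) (k, m)"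
    using True by (simp add: futurity_kernel_def map_pmf_def)
  also have "\<dots> = p (pulled_arm D i) * indicator {(k, m)} (?k, 0::nat)
      + (1 - p (pulled_arm D i)) * indicator {(k, m)} (?k, 1::nat)"
    using assms by (simp add: pmf_bind indicator_def)
  finally show ?thesis using True by (auto simp: indicator_def)
next
  case False
  then show ?thesis by (auto simp: futurity_kernel_def Let_def indicator_def)
qed

lemma stationary_distribution_iff:
  fixes p :: "arm \<Rightarrow> real" and D :: "arm list" and \<pi> :: "(nat \<times> nat) pmf"
  defines "N \<equiv> 2 * length D"
  assumes p: "\<And>a. 0 < p a" "\<And>a. p a < 1" and D: "D \<noteq> []"
    and supp: "set_pmf \<pi> \<subseteq> {0..<N} \<times> {0, 1}"
  shows "stationary_distribution p D \<pi> \<longleftrightarrow>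
    (\<forall>i<N. pmf \<pi> (Suc i mod N, 0) = pmf \<pi> (i, 0) * p (pulled_arm D i) + pmf \<pi> (i, 1) \<and>
           pmf \<pi> (Suc i mod N, 1) = pmf \<pi> (i, 0) * (1 - p (pulled_arm D i)))"
    (is "_ \<longleftrightarrow> ?R")
proof -
  have N: "N > 0" using D by (simp add: N_def)
  have K: "pmf (bind_pmf \<pi> (futurity_kernel p D)) (k, m) =
      (\<Sum>i<N. pmf (futurity_kernel p D (i, 0)) (k, m) * pmf \<pi> (i, 0)
           + pmf (futurity_kernel p D (i, 1)) (k, m) * pmf \<pi> (i, 1))" for k m
  proof -
    have "pmf (bind_pmf \<pi> (futurity_kernel p D)) (k, m) =
        (\<Sum>x\<in>{0..<N} \<times> {0, 1}. pmf (futurity_kernel p D x) (k, m) * pmf \<pi> x)"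
      unfolding pmf_bind
      by (subst integral_measure_pmf_real[of "{0..<N} \<times> {0, 1}"])
         (use supp in auto)
    then show ?thesis unfolding sum_times_01 .
  qed
  have L: "pmf (bind_pmf \<pi> (futurity_kernel p D)) (Suc j mod N, m) =
      pmf (futurity_kernel p D (j, 0)) (Suc j mod N, m) * pmf \<pi> (j, 0)
      + pmf (futurity_kernel p D (j, 1)) (Suc j mod N, m) * pmf \<pi> (j, 1)" if "j < N" for j m
  proof -
    have z: "pmf (futurity_kernel p D (i, l)) (Suc j mod N, m) = 0" if "i < N" "i \<noteq> j" for i l
      using Suc_mod_inj[of i N j] that \<open>j < N\<close> p by (auto simp: pmf_futurity_kernel N_def)
    show ?thesis unfolding K
      by (subst sum.remove[of _ j]) (use that z in \<open>auto intro!: sum.neutral\<close>)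
  qed
  have L0: "pmf (bind_pmf \<pi> (futurity_kernel p D)) (Suc j mod N, 0) =
      pmf \<pi> (j, 0) * p (pulled_arm D j) + pmf \<pi> (j, 1)"
    and L1: "pmf (bind_pmf \<pi> (futurity_kernel p D)) (Suc j mod N, 1) =
      pmf \<pi> (j, 0) * (1 - p (pulled_arm D j))" if "j < N" for j
    using L[OF that] p by (simp_all add: pmf_futurity_kernel N_def)
  show ?thesis
  proof
    assume "stationary_distribution p D \<pi>"
    then have "bind_pmf \<pi> (futurity_kernel p D) = \<pi>"
      by (simp add: stationary_distribution_def)
    then show ?R using L0 L1 by metis
  next
    assume R: ?R
    have "pmf (bind_pmf \<pi> (futurity_kernel p D)) (k, m) = pmf \<pi> (k, m)" for k m
    proof (cases "k < N \<and> m \<in> {0, 1}")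
      case True
      define j where "j = (if k = 0 then N - 1 else k - 1)"
      have j: "j < N" "Suc j mod N = k" using True N by (auto simp: j_def)
      show ?thesis using True R L0[OF j(1)] L1[OF j(1)] j by auto
    next
      case False
      have "pmf \<pi> (k, m) = 0" using False supp by (auto simp: pmf_eq_0_set_pmf)
      moreover have "pmf (bind_pmf \<pi> (futurity_kernel p D)) (k, m) = 0"
        unfolding K using False p N
        by (intro sum.neutral) (auto simp: pmf_futurity_kernel N_def)
      ultimately show ?thesis by simp
    qed
    then have "bind_pmf \<pi> (futurity_kernel p D) = \<pi>" by (intro pmf_eqI) auto
    then show "stationary_distribution p D \<pi>"
      using supp by (simp add: stationary_distribution_def N_def)
  qed
qed

text \<open>
  A stationary distribution gives mass \<open>1 / (2n)\<close> to each position, so the masses of the states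
  \<open>(k, 1)\<close> satisfy the following recurrence, in which \<open>x\<close> is the mass of \<open>(0, 1)\<close>.
\<close>

fun losing_mass :: "(arm \<Rightarrow> real) \<Rightarrow> arm list \<Rightarrow> real \<Rightarrow> nat \<Rightarrow> real" where
  "losing_mass p D x 0 = x"
| "losing_mass p D x (Suc k) =
     (1 / real (2 * length D) - losing_mass p D x k) * (1 - p (pulled_arm D k))"

lemma losing_mass_diff:
  "losing_mass p D x k - losing_mass p D y k =
     (-1) ^ k * (\<Prod>i<k. 1 - p (pulled_arm D i)) * (x - y)"
proof (induction k)
  case (Suc k)
  have "losing_mass p D x (Suc k) - losing_mass p D y (Suc k) =
      - (1 - p (pulled_arm D k)) * (losing_mass p D x k - losing_mass p D y k)"
    by (simp add: algebra_simps)
  then show ?case unfolding Suc by (simp add: algebra_simps)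
qed simp

lemma losing_mass_bounds:
  assumes p: "\<And>a. 0 < p a" "\<And>a. p a < 1" and "0 \<le> x" "x \<le> 1 / real (2 * length D)"
  shows "0 \<le> losing_mass p D x k \<and> losing_mass p D x k \<le> 1 / real (2 * length D)"
proof (induction k)
  case (Suc k)
  let ?c = "1 / real (2 * length D)" and ?q = "1 - p (pulled_arm D k)"
  have q: "0 \<le> ?q" "?q \<le> 1" using p[of "pulled_arm D k"] by auto
  have "0 \<le> (?c - losing_mass p D x k) * ?q" using Suc q by (intro mult_nonneg_nonneg) auto
  moreover have "(?c - losing_mass p D x k) * ?q \<le> ?c * 1"
    using Suc q by (intro mult_mono) auto
  ultimately show ?case by simp
qed (use assms in auto)

lemma prod_loss_less_1:
  fixes p :: "arm \<Rightarrow> real"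
  assumes p: "\<And>a. 0 < p a" "\<And>a. p a < 1" and "N > 0"
  shows "(\<Prod>i<N. 1 - p (pulled_arm D i)) < 1"
proof -
  obtain M where M: "N = Suc M" using \<open>N > 0\<close> by (cases N) auto
  have "(\<Prod>i<M. 1 - p (pulled_arm D i)) \<le> 1"
    by (intro prod_le_1) (use p in \<open>auto simp: less_imp_le\<close>)
  moreover have "(\<Prod>i<M. 1 - p (pulled_arm D i)) \<ge> 0"
    by (intro prod_nonneg) (use p in \<open>auto simp: less_imp_le\<close>)
  ultimately have "(\<Prod>i<M. 1 - p (pulled_arm D i)) * (1 - p (pulled_arm D M))
      \<le> 1 * (1 - p (pulled_arm D M))"
    using p[of "pulled_arm D M"] by (intro mult_right_mono) auto
  also have "\<dots> < 1" using p[of "pulled_arm D M"] by simp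
  finally show ?thesis by (simp add: M)
qed

lemma stationary_distribution_masses:
  fixes p :: "arm \<Rightarrow> real" and D :: "arm list"
  defines "N \<equiv> 2 * length D"
  assumes p: "\<And>a. 0 < p a" "\<And>a. p a < 1" and D: "D \<noteq> []"
    and st: "stationary_distribution p D \<pi>"
  obtains x where "\<And>i. i < N \<Longrightarrow> pmf \<pi> (i, 1) = losing_mass p D x i"
    and "\<And>i. i < N \<Longrightarrow> pmf \<pi> (i, 0) = 1 / real N - losing_mass p D x i"
    and "losing_mass p D x N = x"
proof -
  have N: "N > 0" using D by (simp add: N_def)
  have supp: "set_pmf \<pi> \<subseteq> {0..<N} \<times> {0, 1}"
    using st by (simp add: stationary_distribution_def N_def)
  have bal: "pmf \<pi> (Suc i mod N, 0) = pmf \<pi> (i, 0) * p (pulled_arm D i) + pmf \<pi> (i, 1)"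
    "pmf \<pi> (Suc i mod N, 1) = pmf \<pi> (i, 0) * (1 - p (pulled_arm D i))" if "i < N" for i
    using stationary_distribution_iff[where p = p, OF p D supp[unfolded N_def]] st that
    by (auto simp: N_def)
  define s where "s i = pmf \<pi> (i, 0) + pmf \<pi> (i, 1)" for i
  have s0: "s i = s 0" if "i < N" for i
    using that
  proof (induction i)
    case (Suc i)
    then show ?case using bal[of i] by (simp add: s_def algebra_simps)
  qed simp
  have "1 = (\<Sum>x\<in>{0..<N} \<times> {0, 1}. pmf \<pi> x)"
    using sum_pmf_eq_1[OF _ supp] by simp
  also have "\<dots> = (\<Sum>i<N. s i)"
    unfolding sum_times_01 s_def ..
  also have "\<dots> = (\<Sum>i<N. s 0)" by (intro sum.cong refl s0) simp
  also have "\<dots> = real N * s 0" by simp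
  finally have sN: "s i = 1 / real N" if "i < N" for i
    using N s0[OF that] by (simp add: field_simps)
  define x where "x = pmf \<pi> (0, 1)"
  have y: "pmf \<pi> (i, 1) = losing_mass p D x i" if "i < N" for i
    using that
  proof (induction i)
    case (Suc i)
    then have "pmf \<pi> (i, 0) = 1 / real N - losing_mass p D x i"
      using sN[of i] by (simp add: s_def)
    then show ?case using bal(2)[of i] Suc.prems by (simp flip: N_def)
  qed (simp add: x_def)
  have z: "pmf \<pi> (i, 0) = 1 / real N - losing_mass p D x i" if "i < N" for i
    using sN[OF that] y[OF that] by (simp add: s_def)
  have "losing_mass p D x N = x"
  proof -
    obtain M where M: "N = Suc M" using N by (cases N) auto
    have "losing_mass p D x (Suc M) = (1 / real N - losing_mass p D x M) * (1 - p (pulled_arm D M))"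
      by (simp only: losing_mass.simps(2) N_def)
    also have "\<dots> = pmf \<pi> (Suc M mod N, 1)" using bal(2)[of M] z[of M] M by simp
    also have "\<dots> = x" using M by (simp add: x_def)
    finally show ?thesis unfolding M .
  qed
  then show ?thesis using that y z by blast
qed

lemma ex1_stationary_distribution:
  fixes p :: "arm \<Rightarrow> real" and D :: "arm list"
  assumes p: "\<And>a. 0 < p a" "\<And>a. p a < 1" and D: "D \<noteq> []"
  shows "\<exists>!\<pi>. stationary_distribution p D \<pi>"
proof (rule ex_ex1I)
  define N where "N = 2 * length D"
  have N: "N > 0" and even: "even N" using D by (simp_all add: N_def)
  let ?P = "\<Prod>i<N. 1 - p (pulled_arm D i)"
  have P: "?P < 1" using prod_loss_less_1[where p = p, OF p N] .
  define c where "c = 1 / real N"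
  have c: "c > 0" using N by (simp add: c_def)
  define x where "x = losing_mass p D 0 N / (1 - ?P)"
  have step: "losing_mass p D y N = losing_mass p D 0 N + ?P * y" for y
    using losing_mass_diff[of p D y N 0] even by simp
  have fix_x: "losing_mass p D x N = x"
    using P by (subst step) (simp add: x_def field_simps)
  have x: "0 \<le> x" "x \<le> c"
  proof -
    have "0 \<le> losing_mass p D 0 N" using losing_mass_bounds[where p = p, OF p, of 0 D N] by simp
    then show "0 \<le> x" using P by (simp add: x_def)
    have "losing_mass p D c N \<le> c"
      using losing_mass_bounds[where p = p, OF p, of c D N] c by (simp add: c_def N_def)
    then show "x \<le> c" using P unfolding x_def step[of c] by (simp add: field_simps)
  qed
  have bd: "0 \<le> losing_mass p D x i" "losing_mass p D x i \<le> c" for i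
    using losing_mass_bounds[where p = p, OF p, of x D i] x by (simp_all add: c_def N_def)
  define f where "f = (\<lambda>(i, l). if i < N then
      if l = 0 then c - losing_mass p D x i else if l = (1::nat) then losing_mass p D x i else 0
      else 0)"
  have f0: "0 \<le> f s" for s using bd by (auto simp: f_def split: prod.splits)
  have fS: "f s = 0" if "s \<notin> {0..<N} \<times> {0, 1}" for s
    using that by (auto simp: f_def split: prod.splits)
  have "(\<Sum>s\<in>{0..<N} \<times> {0, 1}. f s) = (\<Sum>i<N. c)"
    unfolding sum_times_01 by (simp add: f_def)
  also have "\<dots> = 1" using N by (simp add: c_def)
  finally have f1: "(\<Sum>s\<in>{0..<N} \<times> {0, 1}. f s) = 1" .
  have "(\<integral>\<^sup>+ s. ennreal (f s) \<partial>count_space UNIV) =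
      (\<Sum>s\<in>{0..<N} \<times> {0, 1}. ennreal (f s))"
    by (rule nn_integral_count_space') (use fS in auto)
  also have "\<dots> = 1" using f0 f1 by (subst sum_ennreal) auto
  finally have int1: "(\<integral>\<^sup>+ s. ennreal (f s) \<partial>count_space UNIV) = 1" .
  define \<pi> where "\<pi> = embed_pmf f"
  have pm: "pmf \<pi> s = f s" for s unfolding \<pi>_def by (rule pmf_embed_pmf[OF f0 int1])
  have supp: "set_pmf \<pi> \<subseteq> {0..<2 * length D} \<times> {0, 1}"
    using fS pm by (metis N_def pmf_eq_0_set_pmf subsetI)
  have wrap: "losing_mass p D x (Suc i mod N) = losing_mass p D x (Suc i)" if "i < N" for i
    using that fix_x by (cases "Suc i = N") (auto simp del: losing_mass.simps(2))
  have "pmf \<pi> (Suc i mod N, 0) = pmf \<pi> (i, 0) * p (pulled_arm D i) + pmf \<pi> (i, 1) \<and>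
      pmf \<pi> (Suc i mod N, 1) = pmf \<pi> (i, 0) * (1 - p (pulled_arm D i))" if "i < N" for i
    using that N wrap[OF that] by (simp add: pm f_def c_def N_def algebra_simps diff_divide_distrib)
  then have "stationary_distribution p D \<pi>"
    unfolding stationary_distribution_iff[where p = p, OF p D supp] N_def by blast
  then show "\<exists>\<pi>. stationary_distribution p D \<pi>" ..
  fix \<pi>1 \<pi>2
  assume st: "stationary_distribution p D \<pi>1" "stationary_distribution p D \<pi>2"
  obtain x1 where x1: "\<And>i. i < N \<Longrightarrow> pmf \<pi>1 (i, 1) = losing_mass p D x1 i"
      "\<And>i. i < N \<Longrightarrow> pmf \<pi>1 (i, 0) = 1 / real N - losing_mass p D x1 i"
      "losing_mass p D x1 N = x1"
    using stationary_distribution_masses[where p = p, OF p D st(1)] unfolding N_def by blast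
  obtain x2 where x2: "\<And>i. i < N \<Longrightarrow> pmf \<pi>2 (i, 1) = losing_mass p D x2 i"
      "\<And>i. i < N \<Longrightarrow> pmf \<pi>2 (i, 0) = 1 / real N - losing_mass p D x2 i"
      "losing_mass p D x2 N = x2"
    using stationary_distribution_masses[where p = p, OF p D st(2)] unfolding N_def by blast
  have "x1 - x2 = ?P * (x1 - x2)"
    using losing_mass_diff[of p D x1 N x2] x1(3) x2(3) even by simp
  then have "(x1 - x2) * (1 - ?P) = 0" by (simp add: algebra_simps)
  then have eq: "x1 = x2" using P by simp
  have "pmf \<pi>1 s = pmf \<pi>2 s" for s
  proof (cases "s \<in> {0..<N} \<times> {0, 1}")
    case True
    then obtain i l where "s = (i, l)" "i < N" "l = 0 \<or> l = 1" by auto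
    then show ?thesis using x1(1,2)[of i] x2(1,2)[of i] eq by auto
  next
    case False
    then have "s \<notin> set_pmf \<pi>1" "s \<notin> set_pmf \<pi>2"
      using st unfolding stationary_distribution_def N_def by blast+
    then show ?thesis by (simp add: set_pmf_iff)
  qed
  then show "\<pi>1 = \<pi>2" by (intro pmf_eqI)
qed

lemma stationary_distribution_stationary_pmf:
  assumes "\<And>a. 0 < p a" "\<And>a. p a < 1" "D \<noteq> []"
  shows "stationary_distribution p D (stationary_pmf p D)"
  unfolding stationary_pmf_def by (rule theI'[OF ex1_stationary_distribution[OF assms]])

lemma arm_futurity_prob_eq:
  assumes p: "\<And>a. 0 < p a" "\<And>a. p a < 1"
  shows "arm_futurity_prob p a = p a * (1 - p a)^2 / (1 - (1 - p a)^2)"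
proof -
  have st: "stationary_distribution p [a] (stationary_pmf p [a])"
    by (rule stationary_distribution_stationary_pmf[where p = p, OF p list.distinct(2)])
  obtain x where x: "\<And>i. i < 2 * length [a] \<Longrightarrow>
      pmf (stationary_pmf p [a]) (i, 1) = losing_mass p [a] x i"
    "losing_mass p [a] x (2 * length [a]) = x"
  proof (rule stationary_distribution_masses[where p = p, OF p list.distinct(2) st])
    fix x
    assume "\<And>i. i < 2 * length [a] \<Longrightarrow>
        pmf (stationary_pmf p [a]) (i, 1) = losing_mass p [a] x i"
      "losing_mass p [a] x (2 * length [a]) = x"
    then show thesis by (rule that)
  qed
  define q where "q = 1 - p a"
  have q: "0 < q" "q < 1" using p[of a] by (auto simp: q_def)
  have "(1 / 2 - (1 / 2 - x) * q) * q = x"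
    using x(2) by (simp add: numeral_2_eq_2 pulled_arm_def q_def)
  then have "(1 - q\<^sup>2) * x = (1 - q) * q / 2" by (simp add: power2_eq_square algebra_simps)
  then have "(1 - q) * ((1 + q) * x) = (1 - q) * (q / 2)"
    by (simp add: power2_eq_square algebra_simps)
  then have "(1 + q) * x = q / 2" using q by (metis less_irrefl mult_left_cancel right_minus_eq)
  then have xe: "x = q / (2 * (1 + q))" using q by (simp add: field_simps)
  have "arm_futurity_prob p a = (x + (1 / 2 - x) * q) * q"
  proof -
    have "pmf (stationary_pmf p [a]) (0, 1) = x"
      "pmf (stationary_pmf p [a]) (1, 1) = (1 / 2 - x) * q"
      using x(1)[of 0] x(1)[of 1] by (simp_all add: pulled_arm_def q_def)
    then show ?thesis
      by (simp add: arm_futurity_prob_def futurity_prob_def numeral_2_eq_2 pulled_arm_def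
          distrib_right flip: q_def)
  qed
  also have "\<dots> = (1 - q) * q\<^sup>2 / (1 - q\<^sup>2)"
  proof -
    have "(1 - q\<^sup>2) = (1 - q) * (1 + q)" by (simp add: power2_eq_square algebra_simps)
    then have "(1 - q) * q\<^sup>2 / (1 - q\<^sup>2) = q\<^sup>2 / (1 + q)" using q by simp
    moreover have "(x + (1 / 2 - x) * q) * q = q\<^sup>2 / (1 + q)"
      unfolding xe using q by (simp add: power2_eq_square divide_simps)
    ultimately show ?thesis by simp
  qed
  finally show ?thesis by (simp add: q_def)
qed

lemma two_armed_profit_eq:
  "two_armed_profit p u D =
     2 * (arm_freq D A * arm_futurity_prob p A + arm_freq D B * arm_futurity_prob p B
          - futurity_prob p D)"
  by (simp add: two_armed_profit_def arm_mean_payout_def pattern_mean_payout_def algebra_simps)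

lemma parrondo_effect_iff:
  assumes p: "\<And>a. 0 < p a" and D: "D \<noteq> []"
  shows "parrondo_effect p D \<longleftrightarrow>
    futurity_prob p D < arm_freq D A * arm_futurity_prob p A + arm_freq D B * arm_futurity_prob p B"
proof -
  have len: "length D = count_list D A + count_list D B" for D
  proof (induction D)
    case (Cons a D)
    then show ?case by (cases a) auto
  qed simp
  have "real (count_list D A) + real (count_list D B) = real (length D)"
    unfolding len by (rule of_nat_add[symmetric])
  then have freq: "arm_freq D A + arm_freq D B = 1"
    using D by (simp add: arm_freq_def flip: add_divide_distrib)
  have *: "1 - pattern_mean_payout p u D = two_armed_profit p u D"
    if "arm_mean_payout p u A = 1" "arm_mean_payout p u B = 1" for u
    using that freq by (simp add: two_armed_profit_def)
  define u0 where "u0 a = (1 - 2 * arm_futurity_prob p a) / p a" for a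
  have fair: "arm_mean_payout p u0 a = 1" for a
    using p[of a] by (simp add: arm_mean_payout_def u0_def)
  have iff: "two_armed_profit p u D > 0 \<longleftrightarrow> futurity_prob p D <
      arm_freq D A * arm_futurity_prob p A + arm_freq D B * arm_futurity_prob p B" for u
    unfolding two_armed_profit_eq by auto
  show ?thesis
  proof
    assume "parrondo_effect p D"
    then have "1 - pattern_mean_payout p u0 D > 0"
      using fair by (simp only: parrondo_effect_def)
    then have "two_armed_profit p u0 D > 0"
      by (simp only: *[OF fair fair])
    then show "futurity_prob p D <
        arm_freq D A * arm_futurity_prob p A + arm_freq D B * arm_futurity_prob p B"
      unfolding iff .
  next
    assume "futurity_prob p D <
        arm_freq D A * arm_futurity_prob p A + arm_freq D B * arm_futurity_prob p B"
    then have "two_armed_profit p u D > 0" for u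
      unfolding iff .
    then show "parrondo_effect p D"
      unfolding parrondo_effect_def using * by simp
  qed
qed

end

theory Submission
  imports Defs
begin

text \<open>
  Let \<open>q\<^sub>i\<close> be the losing probability of the arm pulled at position \<open>i\<close>, and let \<open>y\<^sub>i\<close> be
  the stationary probability that the pointer is at 1, given position \<open>i\<close>. Then
  \<open>y\<^sub>i\<^sub>+\<^sub>1 = (1 - y\<^sub>i) q\<^sub>i\<close> cyclically, and the award probability of the pattern is the mean of
  \<open>y\<^sub>i q\<^sub>i\<close>, while that of a single arm is \<open>q\<^sup>2 / (1 + q)\<close>, with \<open>y\<close> at the fixed
  point \<open>q / (1 + q)\<close>. The identity
  \<open>q\<^sup>2 / (1 + q) - y q = (1 - q\<^sup>2) / 2 * (y - q / (1 + q))\<^sup>2 + (y'\<^sup>2 - y\<^sup>2) / 2\<close> with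
  \<open>y' = (1 - y) q\<close> turns the profit, after the squares of the \<open>y\<^sub>i\<close> telescope, into a sum of
  nonnegative terms. They all vanish only if every \<open>y\<^sub>i\<close> is the fixed point of its arm; since then
  \<open>y\<^sub>i\<^sub>+\<^sub>1 = y\<^sub>i\<close>, the fixed points would all agree, and hence so would the \<open>q\<^sub>i\<close>.
\<close>

lemma award_gap_identity:
  fixes q y :: real
  assumes "0 < q"
  shows "q\<^sup>2 / (1 + q) - y * q =
    (1 - q\<^sup>2) / 2 * (y - q / (1 + q))\<^sup>2 + (((1 - y) * q)\<^sup>2 - y\<^sup>2) / 2"
proof -
  define c where "c = q / (1 + q)"
  have "c * (1 + q) = q" using assms by (simp add: c_def)
  \<comment> \<open>Written without division, the defining relation of \<open>c\<close> leaves
    polynomial goals that \<open>algebra\<close> can close.\<close>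
  then have q: "q = c + c * q" by (simp add: algebra_simps)
  have sq: "q\<^sup>2 / (1 + q) = c * q" by (simp add: c_def power2_eq_square)
  have y': "(1 - y) * q = c - q * (y - c)" using q by algebra
  show ?thesis
    unfolding sq y' c_def[symmetric] using q by algebra
qed

lemma cyclic_award_less:
  fixes q y :: "nat \<Rightarrow> real"
  assumes q: "\<And>i. 0 < q i" "\<And>i. q i < 1"
    and step: "\<And>i. y (Suc i) = (1 - y i) * q i" and cyc: "y N = y 0"
    and jk: "j < N" "k < N" "q j \<noteq> q k"
  shows "(\<Sum>i<N. y i * q i) < (\<Sum>i<N. (q i)\<^sup>2 / (1 + q i))"
proof -
  define c where "c i = q i / (1 + q i)" for i
  define e where "e i = (1 - (q i)\<^sup>2) / 2 * (y i - c i)\<^sup>2" for i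
  have q2: "(q i)\<^sup>2 < 1" for i
    using q[of i] by (simp add: power2_eq_square mult_less_cancel_right_disj less_trans[of _ "q i"])
  have e0: "0 \<le> e i" for i using q2[of i] by (simp add: e_def)
  have "(\<Sum>i<N. (q i)\<^sup>2 / (1 + q i)) - (\<Sum>i<N. y i * q i) =
      (\<Sum>i<N. e i + ((y (Suc i))\<^sup>2 - (y i)\<^sup>2) / 2)"
    unfolding sum_subtractf[symmetric] step e_def c_def
    by (intro sum.cong refl award_gap_identity q)
  also have "\<dots> = sum e {..<N} + ((y N)\<^sup>2 - (y 0)\<^sup>2) / 2"
    unfolding sum.distrib sum_divide_distrib[symmetric] sum_lessThan_telescope[of "\<lambda>i. (y i)\<^sup>2"] ..
  also have "\<dots> = sum e {..<N}" by (simp add: cyc)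
  finally have diff: "(\<Sum>i<N. (q i)\<^sup>2 / (1 + q i)) - (\<Sum>i<N. y i * q i) = sum e {..<N}" .
  have "sum e {..<N} \<noteq> 0"
  proof
    assume "sum e {..<N} = 0"
    then have "\<forall>i<N. e i = 0" using e0 by (simp add: sum_nonneg_eq_0_iff)
    \<comment> \<open>The coefficient of the square in \<open>e i\<close> is positive by
      \<open>q2\<close>, so the square itself vanishes.\<close>
    then have yc: "y i = c i" if "i < N" for i
      using that q2[of i] by (auto simp: e_def)
    have fixp: "(1 - c i) * q i = c i" for i
      using q(1)[of i] by (simp add: c_def field_simps)
    have const: "y i = y 0" if "i < N" for i
      using that
    proof (induction i)
      case (Suc i)
      then show ?case using step[of i] yc[of i] fixp[of i] by simp
    qed simp
    have "c j = c k" using const yc jk by metis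
    \<comment> \<open>The map sending \<open>t\<close> to \<open>t / (1 + t)\<close> is injective on
      positive reals.\<close>
    then have "q j = q k"
      using q(1)[of j] q(1)[of k] by (simp add: c_def field_simps)
    then show False using jk by simp
  qed
  moreover have "0 \<le> sum e {..<N}" using e0 by (simp add: sum_nonneg)
  ultimately show ?thesis using diff by linarith
qed

lemma sum_list_arms:
  fixes f :: "arm \<Rightarrow> real"
  shows "(\<Sum>a\<leftarrow>D. f a) = real (count_list D A) * f A + real (count_list D B) * f B"
proof (induction D)
  case (Cons a D)
  then show ?case by (cases a) (auto simp: algebra_simps)
qed simp

text \<open>The positions of the chain run through the word exactly twice, which turns sums over
  positions into letter counts.\<close>

lemma sum_pulled_arm:
  fixes f :: "arm \<Rightarrow> real"
  shows "(\<Sum>i<2 * length D. f (pulled_arm D i)) =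
    2 * (real (count_list D A) * f A + real (count_list D B) * f B)"
proof -
  have "(\<Sum>i<length D. f (pulled_arm D i)) = (\<Sum>a\<leftarrow>D. f a)"
    by (simp add: sum_list_sum_nth lessThan_atLeast0 pulled_arm_def)
  moreover have "(\<Sum>i<2 * length D. f (pulled_arm D i)) =
      (\<Sum>i<length D. f (pulled_arm D i)) + (\<Sum>i<length D. f (pulled_arm D (i + length D)))"
    using sum.atLeastLessThan_concat[of 0 "length D" "length D + length D" "\<lambda>i. f (pulled_arm D i)"]
      sum.shift_bounds_nat_ivl[of "\<lambda>i. f (pulled_arm D i)" 0 "length D" "length D"]
    by (simp add: lessThan_atLeast0 mult_2)
  ultimately show ?thesis by (simp add: pulled_arm_def sum_list_arms)
qed

lemma futurity_prob_less:
  fixes p :: "arm \<Rightarrow> real" and D :: "arm list"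
  assumes p: "\<And>a. 0 < p a" "\<And>a. p a < 1" and ne: "p A \<noteq> p B"
    and AB: "A \<in> set D" "B \<in> set D"
  shows "futurity_prob p D <
    arm_freq D A * arm_futurity_prob p A + arm_freq D B * arm_futurity_prob p B"
proof -
  define N where "N = 2 * length D"
  have D: "D \<noteq> []" using AB by auto
  then have N: "N > 0" by (simp add: N_def)
  define q where "q i = 1 - p (pulled_arm D i)" for i
  have q: "0 < q i" "q i < 1" for i using p by (simp_all add: q_def)
  obtain x where x: "\<And>i. i < N \<Longrightarrow> pmf (stationary_pmf p D) (i, 1) = losing_mass p D x i"
      "losing_mass p D x N = x"
    using stationary_distribution_masses[where p = p, OF p D
        stationary_distribution_stationary_pmf[where p = p, OF p D]]
    unfolding N_def by blast
  \<comment> \<open>Each position has mass \<open>1 / N\<close>, so scaling by \<open>N\<close>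
    gives the conditional probability that the pointer is at 1.\<close>
  define y where "y i = real N * losing_mass p D x i" for i
  have step: "y (Suc i) = (1 - y i) * q i" for i
    using N by (simp add: y_def q_def right_diff_distrib flip: N_def mult.assoc)
  have cyc: "y N = y 0" using x(2) by (simp add: y_def)
  obtain j where j: "j < length D" "D ! j = A" using AB(1) by (auto simp: in_set_conv_nth)
  obtain k where k: "k < length D" "D ! k = B" using AB(2) by (auto simp: in_set_conv_nth)
  have jk: "j < N" "k < N" "q j \<noteq> q k"
    using j k ne by (simp_all add: N_def q_def pulled_arm_def)
  \<comment> \<open>Cancelling \<open>p a\<close> from the closed form gives the shape used in
    \<open>cyclic_award_less\<close>.\<close>
  have single: "arm_futurity_prob p a = (1 - p a)\<^sup>2 / (1 + (1 - p a))" for a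
  proof -
    have "1 - (1 - p a)\<^sup>2 = p a * (1 + (1 - p a))" by (simp add: power2_eq_square algebra_simps)
    then show ?thesis using p(1)[of a] by (simp add: arm_futurity_prob_eq[where p = p, OF p])
  qed
  have "real N * futurity_prob p D = (\<Sum>i<N. y i * q i)"
    unfolding futurity_prob_def sum_distrib_left N_def[symmetric]
    by (intro sum.cong refl) (simp only: lessThan_iff x(1) y_def q_def mult.assoc)
  also have "\<dots> < (\<Sum>i<N. (q i)\<^sup>2 / (1 + q i))"
    by (rule cyclic_award_less[of q y N j k, OF q step cyc jk])
  also have "\<dots> = (\<Sum>i<2 * length D. arm_futurity_prob p (pulled_arm D i))"
    by (simp add: N_def q_def single)
  also have "\<dots> = real N *
      (arm_freq D A * arm_futurity_prob p A + arm_freq D B * arm_futurity_prob p B)"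
    unfolding sum_pulled_arm using D by (simp add: N_def arm_freq_def field_simps)
  finally show ?thesis using N by simp
qed

theorem theorem8:
  fixes p u :: "arm \<Rightarrow> real" and D :: "arm list"
  assumes "0 < p A" and "p A < 1" and "0 < p B" and "p B < 1" and "p A \<noteq> p B"
    and "A \<in> set D" and "B \<in> set D"
  shows "two_armed_profit p u D > 0 \<and> parrondo_effect p D"
proof -
  have p: "0 < p a" "p a < 1" for a using assms by (cases a; simp)+
  have D: "D \<noteq> []" using assms by auto
  have less: "futurity_prob p D <
      arm_freq D A * arm_futurity_prob p A + arm_freq D B * arm_futurity_prob p B"
    using assms by (intro futurity_prob_less p)
  then have "parrondo_effect p D"
    unfolding parrondo_effect_iff[where p = p, OF p(1) D] .
  with less show ?thesis by (simp add: two_armed_profit_eq)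
qed

end
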